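(* Let $\Gamma$ be a zero-sum stochastic game in the class $\mathcal G$. The minimax value $\tilde v_\Gamma$ Player 2 can guarantee in static strategies and the minimax value $v_\Gamma$ he can guarantee in stationary strategies satisfy $$\tilde v_\Gamma-v_\Gamma\ \le\ \tfrac34\,(1-v_\Gamma).$$ Equivalently (when $v_\Gamma<1$), $$\frac{1-\tilde v_\Gamma}{1-v_\Gamma}\ \ge\ \frac14 .$$
   Context: The class $\mathcal G$ consists of the following zero-sum stochastic games. $I$ and $J$ are the finite action sets of Player 1 (maximizer) and Player 2 (minimizer), the same in every state; the set of states is $S=J$; the transition function $q:S\times I\times J\to\Delta(S)$ is $q(s,i,j)=\delta_j$ for all $(s,i,j)$, i.e. the state at stage $t+1$ is the action played by Player 2 at stage $t$; and the payoff function to Player 1 is $r:S\times I\times J\to[0,1]$ with $\min_{s,i,j}r(s,i,j)=0$ and $\max_{s,i,j}r(s,i,j)=1$. A stationary strategy is one whose mixed action at each stage depends only on the current state; $\Sigma$ and $\mathcal T$ denote the sets of stationary strategies of Player 1 and Player 2. A static strategy plays the same mixed action at every stage, independently of the stage and the history (including the state); $\mathcal T_f$ denotes the set of static strategies of Player 2. For an initial state $s$ and $(\sigma,\tau)\in\Sigma\times\mathcal T$, let $$\gamma(s,\sigma,\tau)=\mathbb E_{s,\sigma,\tau}\Big(\liminf_{T\to\infty}\frac1T\sum_{t=1}^T r(s_t,i_t,j_t)\Big).$$ Define $v_\Gamma=\inf_{\tau\in\mathcal T}\sup_{\sigma\in\Sigma}\gamma(s,\sigma,\tau)$ and $\tilde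 v_\Gamma=\inf_{\tau\in\mathcal T_f}\sup_{\sigma\in\Sigma}\gamma(s,\sigma,\tau)$; both are independent of the initial state $s$ because of the structure of the transitions. *)

theory Defs
  imports "HOL-Probability.Probability"
begin

text \<open>
  Action sets and state set are types of class \<open>finite\<close>, hence finite and nonempty.
  Player 1 (the maximizer) chooses from \<open>'i\<close>, Player 2 (the minimizer) from \<open>'j\<close>.
\<close>

record ('s, 'i, 'j) stoch_game =
  transition :: "'s \<Rightarrow> 'i \<Rightarrow> 'j \<Rightarrow> 's pmf"
  payoff :: "'s \<Rightarrow> 'i \<Rightarrow> 'j \<Rightarrow> real"

definition class_G :: "('j::finite, 'i::finite, 'j) stoch_game \<Rightarrow> bool" where
  "class_G \<Gamma> \<longleftrightarrow>
     (\<forall>s i j. transition \<Gamma> s i j = return_pmf j) \<and>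
     (\<forall>s i j. payoff \<Gamma> s i j \<in> {0..1}) \<and>
     Min (range (\<lambda>(s, i, j). payoff \<Gamma> s i j)) = 0 \<and>
     Max (range (\<lambda>(s, i, j). payoff \<Gamma> s i j)) = 1"

type_synonym ('s, 'a) stationary = "'s \<Rightarrow> 'a pmf"

definition static_strategies :: "('s, 'a) stationary set" where
  "static_strategies = {\<tau>. \<exists>y. \<tau> = (\<lambda>_. y)}"

text \<open>
  A play is a sequence of triples (state, action of Player 1, action of Player 2); its entry
  \<open>n\<close> describes stage \<open>n + 1\<close>. Given the current state, the players draw their actions
  independently.
\<close>

definition stage_law ::
  "('s, 'i) stationary \<Rightarrow> ('s, 'j) stationary \<Rightarrow> 's \<Rightarrow> ('s \<times> 'i \<times> 'j) pmf" where
  "stage_law \<sigma> \<tau> s = map_pmf (Pair s) (pair_pmf (\<sigma> s) (\<tau> s))"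

definition state_law ::
  "('s, 'i, 'j) stoch_game \<Rightarrow> 's \<Rightarrow> nat \<Rightarrow> (nat \<Rightarrow> 's \<times> 'i \<times> 'j) \<Rightarrow> 's pmf" where
  "state_law \<Gamma> s\<^sub>1 n \<omega> =
     (case n of 0 \<Rightarrow> return_pmf s\<^sub>1 | Suc m \<Rightarrow> (case \<omega> m of (s, i, j) \<Rightarrow> transition \<Gamma> s i j))"

definition play_kernel ::
  "('s, 'i, 'j) stoch_game \<Rightarrow> 's \<Rightarrow> ('s, 'i) stationary \<Rightarrow> ('s, 'j) stationary
     \<Rightarrow> nat \<Rightarrow> (nat \<Rightarrow> 's \<times> 'i \<times> 'j) \<Rightarrow> ('s \<times> 'i \<times> 'j) measure" where
  "play_kernel \<Gamma> s\<^sub>1 \<sigma> \<tau> n \<omega> = measure_pmf (bind_pmf (state_law \<Gamma> s\<^sub>1 n \<omega>) (stage_law \<sigma> \<tau>))"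

lemma Ionescu_Tulcea_play_kernel:
  fixes \<Gamma> :: "('s::finite, 'i::finite, 'j::finite) stoch_game"
  shows "Ionescu_Tulcea (play_kernel \<Gamma> s\<^sub>1 \<sigma> \<tau>) (\<lambda>_. count_space UNIV)"
proof (rule Ionescu_Tulcea.intro)
  fix n :: nat
  let ?M = "Pi\<^sub>M {0..<n} (\<lambda>_. count_space UNIV) :: (nat \<Rightarrow> 's \<times> 'i \<times> 'j) measure"
  show "play_kernel \<Gamma> s\<^sub>1 \<sigma> \<tau> n \<in> measurable ?M (subprob_algebra (count_space UNIV))"
  proof (cases n)
    case 0
    then show ?thesis
      by (simp add: play_kernel_def [abs_def] state_law_def measure_pmf_in_subprob_algebra)
  next
    case (Suc m)
    let ?k = "\<lambda>(s, i, j). measure_pmf (bind_pmf (transition \<Gamma> s i j) (stage_law \<sigma> \<tau>))"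
    have "(\<lambda>\<omega>. \<omega> m) \<in> measurable ?M (count_space UNIV)"
      using Suc by (intro measurable_component_singleton) auto
    moreover have "?k \<in> measurable (count_space UNIV) (subprob_algebra (count_space UNIV))"
      by (auto simp: measure_pmf_in_subprob_algebra)
    ultimately have "(\<lambda>\<omega>. ?k (\<omega> m)) \<in> measurable ?M (subprob_algebra (count_space UNIV))"
      by (rule measurable_compose)
    moreover have "play_kernel \<Gamma> s\<^sub>1 \<sigma> \<tau> n = (\<lambda>\<omega>. ?k (\<omega> m))"
      by (auto simp: play_kernel_def state_law_def Suc split: prod.split)
    ultimately show ?thesis by simp
  qed
next
  show "prob_space (play_kernel \<Gamma> s\<^sub>1 \<sigma> \<tau> n \<omega>)" for n \<omega>
    unfolding play_kernel_def by (rule measure_pmf.prob_space_axioms)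
qed

text \<open>The law of the play, obtained from the kernels by the Ionescu-Tulcea theorem.\<close>

definition play_measure ::
  "('s::finite, 'i::finite, 'j::finite) stoch_game \<Rightarrow> 's \<Rightarrow> ('s, 'i) stationary
     \<Rightarrow> ('s, 'j) stationary \<Rightarrow> (nat \<Rightarrow> 's \<times> 'i \<times> 'j) measure" where
  "play_measure \<Gamma> s\<^sub>1 \<sigma> \<tau> =
     projective_family.lim UNIV
       (Ionescu_Tulcea.CI (play_kernel \<Gamma> s\<^sub>1 \<sigma> \<tau>) (\<lambda>_. count_space UNIV))
       (\<lambda>_. count_space UNIV)"

lemma prob_space_play_measure: "prob_space (play_measure \<Gamma> s\<^sub>1 \<sigma> \<tau>)"
proof -
  interpret Ionescu_Tulcea "play_kernel \<Gamma> s\<^sub>1 \<sigma> \<tau>" "\<lambda>_. count_space UNIV"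
    by (rule Ionescu_Tulcea_play_kernel)
  have "emeasure (CI {}) (space (PiM {} (\<lambda>_. count_space UNIV))) = 1"
    using prob_space.emeasure_space_1 [OF PF.prob_space_P, of "{}"] by (simp add: PF.space_P)
  then have "emeasure PF.lim (PF.emb UNIV {} (space (PiM {} (\<lambda>_. count_space UNIV)))) = 1"
    by (subst lim) auto
  moreover have "PF.emb UNIV {} (space (PiM {} (\<lambda>_. count_space UNIV))) = space PF.lim"
    by (auto simp: prod_emb_def space_PiM)
  ultimately show ?thesis
    by (auto simp: play_measure_def intro: prob_spaceI)
qed

lemma sets_play_measure [measurable_cong]:
  "sets (play_measure \<Gamma> s\<^sub>1 \<sigma> \<tau>) = sets (PiM UNIV (\<lambda>_. count_space UNIV))"
proof -
  interpret Ionescu_Tulcea "play_kernel \<Gamma> s\<^sub>1 \<sigma> \<tau>" "\<lambda>_. count_space UNIV"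
    by (rule Ionescu_Tulcea_play_kernel)
  show ?thesis
    by (simp add: play_measure_def PF.sets_lim)
qed

text \<open>
  \<open>liminf\<close> is only available on complete lattices, hence the detour through \<open>ereal\<close>; it
  is harmless since payoffs are bounded. The value at \<open>T = 0\<close> does not affect the limit inferior.
\<close>

definition liminf_payoff :: "('s, 'i, 'j) stoch_game \<Rightarrow> (nat \<Rightarrow> 's \<times> 'i \<times> 'j) \<Rightarrow> real" where
  "liminf_payoff \<Gamma> \<omega> =
     real_of_ereal (liminf (\<lambda>T. ereal
       (1 / real T * (\<Sum>t<T. case \<omega> t of (s, i, j) \<Rightarrow> payoff \<Gamma> s i j))))"

definition gamma ::
  "('s::finite, 'i::finite, 'j::finite) stoch_game \<Rightarrow> 's \<Rightarrow> ('s, 'i) stationary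
     \<Rightarrow> ('s, 'j) stationary \<Rightarrow> real" where
  "gamma \<Gamma> s \<sigma> \<tau> = (\<integral>\<omega>. liminf_payoff \<Gamma> \<omega> \<partial>play_measure \<Gamma> s \<sigma> \<tau>)"

definition minimax_stationary ::
  "('s::finite, 'i::finite, 'j::finite) stoch_game \<Rightarrow> 's \<Rightarrow> real" where
  "minimax_stationary \<Gamma> s = (INF \<tau>. SUP \<sigma>. gamma \<Gamma> s \<sigma> \<tau>)"

definition minimax_static ::
  "('s::finite, 'i::finite, 'j::finite) stoch_game \<Rightarrow> 's \<Rightarrow> real" where
  "minimax_static \<Gamma> s = (INF \<tau>\<in>static_strategies. SUP \<sigma>. gamma \<Gamma> s \<sigma> \<tau>)"

lemma liminf_payoff_bounds:
  assumes "\<And>s i j. payoff \<Gamma> s i j \<in> {0..1}"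
  shows "liminf_payoff \<Gamma> \<omega> \<in> {0..1}"
proof -
  define u where "u T = 1 / real T * (\<Sum>t<T. case \<omega> t of (s, i, j) \<Rightarrow> payoff \<Gamma> s i j)" for T
  have *: "(case x of (s, i, j) \<Rightarrow> payoff \<Gamma> s i j) \<in> {0..1}" for x
    using assms by (auto split: prod.split)
  have "(\<Sum>t<T. case \<omega> t of (s, i, j) \<Rightarrow> payoff \<Gamma> s i j) \<le> real T" for T
    using sum_mono [of "{..<T}" "\<lambda>t. case \<omega> t of (s, i, j) \<Rightarrow> payoff \<Gamma> s i j" "\<lambda>_. 1"] *
    by auto
  then have "u T \<le> 1" for T
    by (cases "T = 0") (auto simp: u_def field_simps)
  moreover have "0 \<le> u T" for T
    unfolding u_def using * by (intro mult_nonneg_nonneg sum_nonneg) auto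
  ultimately have "0 \<le> liminf (\<lambda>T. ereal (u T))" "liminf (\<lambda>T. ereal (u T)) \<le> 1"
    by (auto intro!: Liminf_bounded Liminf_le)
  then show ?thesis
    unfolding liminf_payoff_def u_def [symmetric]
    by (cases "liminf (\<lambda>T. ereal (u T))") auto
qed

lemma measurable_liminf_payoff:
  fixes \<Gamma> :: "('s::finite, 'i::finite, 'j::finite) stoch_game"
  shows "liminf_payoff \<Gamma> \<in> borel_measurable (play_measure \<Gamma> s \<sigma> \<tau>)"
proof -
  have [measurable]: "(\<lambda>\<omega>. case \<omega> t of (s, i, j) \<Rightarrow> payoff \<Gamma> s i j)
      \<in> borel_measurable (PiM UNIV (\<lambda>_. count_space UNIV))" for t
    by (rule measurable_compose [OF measurable_component_singleton [of t]]) auto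
  show ?thesis
    unfolding liminf_payoff_def [abs_def] by measurable
qed

lemma gamma_bounds:
  assumes "\<And>s i j. payoff \<Gamma> s i j \<in> {0..1}"
  shows "gamma \<Gamma> s \<sigma> \<tau> \<in> {0..1}"
proof -
  interpret prob_space "play_measure \<Gamma> s \<sigma> \<tau>" by (rule prob_space_play_measure)
  have b: "0 \<le> liminf_payoff \<Gamma> \<omega>" "liminf_payoff \<Gamma> \<omega> \<le> 1" for \<omega>
    using liminf_payoff_bounds [OF assms] by auto
  have "integrable (play_measure \<Gamma> s \<sigma> \<tau>) (liminf_payoff \<Gamma>)"
    using b by (intro integrable_const_bound [where B = 1]) (auto intro: measurable_liminf_payoff)
  then show ?thesis
    using b integral_le_const [of "liminf_payoff \<Gamma>" 1] by (auto simp: gamma_def)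
qed

end

theory Submission
  imports Defs
begin

text \<open>
  Fix a stationary strategy \<open>\<tau>\<close> of Player 2. The larger
  \<open>best s' = max\<^sub>i E\<^bsub>j \<sim> \<tau>(s')\<^esub> r(s', i, j)\<close>, the worse \<open>\<tau>\<close> does in state \<open>s'\<close>. Let
  \<open>s\<^sub>0\<close> be a state where \<open>best\<close> takes its least value \<open>m\<close>. Two estimates compare \<open>\<tau>\<close> with a
  static strategy.

  Against \<open>\<tau>\<close>, Player 1 secures \<open>m\<close> by playing a best reply in every state, since then the
  conditional expectation of each stage payoff given the past is at least \<open>m\<close>
  (\<open>SUP_gamma_ge\<close>).

  On the other hand, let Player 2 always play \<open>y = (\<delta>\<^bsub>s\<^sub>0\<^esub> + \<tau>(s\<^sub>0)) / 2\<close>. The states are then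
  independent with law \<open>y\<close> from the second stage on. With probability at least \<open>1/2\<close> the state is
  \<open>s\<^sub>0\<close>, and with conditional probability \<open>1/2\<close> the action is then drawn from \<open>\<tau>(s\<^sub>0)\<close>, where
  Player 1 gets at most \<open>m\<close> on average whatever he does. So on an event of
  probability at least \<open>1/4\<close> Player 1 expects at most \<open>m\<close>, elsewhere at most 1, and the static
  value is at most \<open>3/4 + m/4\<close> (\<open>minimax_static_le\<close>). Together,
  \<open>minimax_static \<le> 3/4 + 1/4 * (SUP \<sigma>. gamma \<sigma> \<tau>)\<close> for every \<open>\<tau>\<close>, and the infimum over \<open>\<tau>\<close>
  gives the claim.

  The two estimates need different tools, because the payoff is the expectation of a limit
  inferior. The upper bound only needs Fatou's lemma and the mean of each stage payoff
  (\<open>gamma_static_le\<close>). The lower bound needs a strong law for dependent stage payoffs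
  (\<open>gamma_ge\<close>): Hoeffding's lemma bounds the conditional exponential moment at each stage, these
  bounds multiply along the play, Chernoff's inequality turns the product into an exponentially
  small probability of a low average, and Borel-Cantelli excludes infinitely many low averages.
\<close>

section \<open>Integration along the play, one stage at a time\<close>

lemma (in Ionescu_Tulcea) distr_lim_restrict:
  "distr PF.lim (PiM {0..<n} M) (\<lambda>\<omega>. restrict \<omega> {0..<n}) = C 0 n (\<lambda>_. undefined)"
proof (rule measure_eqI)
  fix A assume "A \<in> sets (distr PF.lim (PiM {0..<n} M) (\<lambda>\<omega>. restrict \<omega> {0..<n}))"
  then have A [measurable]: "A \<in> sets (PiM {0..<n} M)" by simp
  have "emeasure (distr PF.lim (PiM {0..<n} M) (\<lambda>\<omega>. restrict \<omega> {0..<n})) A =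
      emeasure PF.lim (PF.emb UNIV {0..<n} A)"
    by (rule emeasure_distr_restrict) (auto simp: PF.sets_lim)
  also have "\<dots> = emeasure (CI {0..<n}) A"
    by (rule lim) auto
  also have "\<dots> = emeasure (C 0 n (\<lambda>_. undefined)) (PF.emb {0..<n} {0..<n} A)"
    by (rule emeasure_CI) auto
  also have "PF.emb {0..<n} {0..<n} A = A"
    by (rule prod_emb_id) (use sets.sets_into_space[OF A] in \<open>auto simp: space_PiM\<close>)
  finally show "emeasure (distr PF.lim (PiM {0..<n} M) (\<lambda>\<omega>. restrict \<omega> {0..<n})) A =
      emeasure (C 0 n (\<lambda>_. undefined)) A" .
qed (simp add: sets_C)

text \<open>
  The Ionescu-Tulcea limit is characterized by its values on cylinder sets. This is the form in
  which it is used: the last coordinate can be integrated out against its kernel.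
\<close>

lemma (in Ionescu_Tulcea) nn_integral_lim_Suc:
  assumes f [measurable]: "f \<in> borel_measurable (PiM {0..<Suc n} M)"
  shows "(\<integral>\<^sup>+\<omega>. f (restrict \<omega> {0..<Suc n}) \<partial>PF.lim) =
    (\<integral>\<^sup>+\<omega>. (\<integral>\<^sup>+x. f ((restrict \<omega> {0..<n})(n := x)) \<partial>P n (restrict \<omega> {0..<n})) \<partial>PF.lim)"
proof -
  have res [measurable]: "(\<lambda>\<omega>. restrict \<omega> {0..<k}) \<in> measurable PF.lim (PiM {0..<k} M)" for k
    by (subst measurable_cong_sets[OF PF.sets_lim refl]) (auto intro: measurable_restrict_subset)
  have "(\<integral>\<^sup>+\<omega>. f (restrict \<omega> {0..<Suc n}) \<partial>PF.lim) =
      (\<integral>\<^sup>+\<omega>. f \<omega> \<partial>distr PF.lim (PiM {0..<Suc n} M) (\<lambda>\<omega>. restrict \<omega> {0..<Suc n}))"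
    by (subst nn_integral_distr) auto
  also have "\<dots> = (\<integral>\<^sup>+\<omega>. f \<omega> \<partial>(C 0 n (\<lambda>_. undefined) \<bind> eP n))"
    by (subst distr_lim_restrict) simp
  also have "\<dots> = (\<integral>\<^sup>+\<omega>. (\<integral>\<^sup>+x. f x \<partial>eP n \<omega>) \<partial>C 0 n (\<lambda>_. undefined))"
    by (rule nn_integral_bind[OF f]) (simp add: measurable_cong_sets[OF sets_C refl])
  also have "\<dots> = (\<integral>\<^sup>+\<omega>. (\<integral>\<^sup>+x. f x \<partial>eP n \<omega>)
      \<partial>distr PF.lim (PiM {0..<n} M) (\<lambda>\<omega>. restrict \<omega> {0..<n}))"
    by (subst distr_lim_restrict) simp
  also have "\<dots> = (\<integral>\<^sup>+\<omega>. (\<integral>\<^sup>+x. f x \<partial>eP n (restrict \<omega> {0..<n})) \<partial>PF.lim)"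
    by (rule nn_integral_distr) measurable
  also have "\<dots> = (\<integral>\<^sup>+\<omega>. (\<integral>\<^sup>+x. f ((restrict \<omega> {0..<n})(n := x)) \<partial>P n (restrict \<omega> {0..<n})) \<partial>PF.lim)"
    by (intro nn_integral_cong nn_integral_eP f measurable_space[OF res])
  finally show ?thesis .
qed

text \<open>
  The tower property for the play: \<open>F\<close> depends on the stages before \<open>n\<close> only, so it may be
  pulled out of the conditional expectation of \<open>g\<close> given these stages, which is its integral
  against the kernel.
\<close>

lemma nn_integral_play_step:
  fixes \<Gamma> :: "('s::finite, 'i::finite, 'j::finite) stoch_game" and g :: "'s \<times> 'i \<times> 'j \<Rightarrow> ennreal"
  assumes F [measurable]: "F \<in> borel_measurable (PiM {0..<n} (\<lambda>_. count_space UNIV))"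
    and past: "\<And>\<omega>. F (restrict \<omega> {0..<n}) = F \<omega>"
  shows "(\<integral>\<^sup>+\<omega>. F \<omega> * g (\<omega> n) \<partial>play_measure \<Gamma> s \<sigma> \<tau>) =
    (\<integral>\<^sup>+\<omega>. F \<omega> * (\<integral>\<^sup>+x. g x \<partial>play_kernel \<Gamma> s \<sigma> \<tau> n \<omega>) \<partial>play_measure \<Gamma> s \<sigma> \<tau>)"
proof -
  interpret Ionescu_Tulcea "play_kernel \<Gamma> s \<sigma> \<tau>" "\<lambda>_. count_space UNIV"
    by (rule Ionescu_Tulcea_play_kernel)
  let ?f = "\<lambda>\<eta>. F (restrict \<eta> {0..<n}) * g (\<eta> n)"
  have "(\<lambda>\<eta>. restrict \<eta> {0..<n}) \<in> measurable (PiM {0..<Suc n} (\<lambda>_. count_space UNIV))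
      (PiM {0..<n} (\<lambda>_. count_space UNIV :: ('s \<times> 'i \<times> 'j) measure))"
    by (rule measurable_restrict_subset) auto
  moreover have "(\<lambda>\<eta>. g (\<eta> n)) \<in> borel_measurable (PiM {0..<Suc n} (\<lambda>_. count_space UNIV))"
    by (rule measurable_compose[OF measurable_component_singleton]) auto
  ultimately have f: "?f \<in> borel_measurable (PiM {0..<Suc n} (\<lambda>_. count_space UNIV))"
    by measurable
  have kernel: "play_kernel \<Gamma> s \<sigma> \<tau> n (restrict \<omega> {0..<n}) = play_kernel \<Gamma> s \<sigma> \<tau> n \<omega>" for \<omega>
    by (auto simp: play_kernel_def state_law_def split: nat.split)
  have measurable_play_kernel: "g \<in> borel_measurable (play_kernel \<Gamma> s \<sigma> \<tau> n \<omega>)" for \<omega>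
    by (simp add: play_kernel_def)
  have F_upd: "F ((restrict \<omega> {0..<n})(n := x)) = F \<omega>" for \<omega> x
  proof -
    have "F ((restrict \<omega> {0..<n})(n := x)) = F (restrict ((restrict \<omega> {0..<n})(n := x)) {0..<n})"
      by (rule past[symmetric])
    also have "restrict ((restrict \<omega> {0..<n})(n := x)) {0..<n} = restrict \<omega> {0..<n}"
      by auto
    finally show ?thesis by (simp only: past)
  qed
  show ?thesis
    using nn_integral_lim_Suc[OF f]
    by (simp add: past F_upd kernel play_measure_def[symmetric] nn_integral_cmult
        measurable_play_kernel)
qed

section \<open>Average payoffs and their limit inferior\<close>

abbreviation stage_payoff :: "('s, 'i, 'j) stoch_game \<Rightarrow> 's \<times> 'i \<times> 'j \<Rightarrow> real" where
  "stage_payoff \<Gamma> x \<equiv> (case x of (s, i, j) \<Rightarrow> payoff \<Gamma> s i j)"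

abbreviation average_payoff ::
  "('s, 'i, 'j) stoch_game \<Rightarrow> (nat \<Rightarrow> 's \<times> 'i \<times> 'j) \<Rightarrow> nat \<Rightarrow> real" where
  "average_payoff \<Gamma> \<omega> T \<equiv> 1 / real T * (\<Sum>t<T. stage_payoff \<Gamma> (\<omega> t))"

text \<open>
  Since the averages lie in the unit interval, the limit inferior is finite and nothing is lost in
  its conversion to a real number.
\<close>

lemma ereal_liminf_payoff:
  assumes "\<And>s i j. payoff \<Gamma> s i j \<in> {0..1}"
  shows "ereal (liminf_payoff \<Gamma> \<omega>) = liminf (\<lambda>T. ereal (average_payoff \<Gamma> \<omega> T))"
proof -
  have *: "stage_payoff \<Gamma> x \<in> {0..1}" for x
    using assms by (auto split: prod.split)
  have "(\<Sum>t<T. stage_payoff \<Gamma> (\<omega> t)) \<le> real T" for T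
    using sum_mono[of "{..<T}" "\<lambda>t. stage_payoff \<Gamma> (\<omega> t)" "\<lambda>_. 1"] * by auto
  then have "average_payoff \<Gamma> \<omega> T \<le> 1" for T
    by (cases "T = 0") (auto simp: field_simps)
  moreover have "0 \<le> average_payoff \<Gamma> \<omega> T" for T
    using * by (intro mult_nonneg_nonneg sum_nonneg) auto
  ultimately have "0 \<le> liminf (\<lambda>T. ereal (average_payoff \<Gamma> \<omega> T))"
      "liminf (\<lambda>T. ereal (average_payoff \<Gamma> \<omega> T)) \<le> 1"
    by (auto intro!: Liminf_bounded Liminf_le)
  then show ?thesis
    unfolding liminf_payoff_def
    by (cases "liminf (\<lambda>T. ereal (average_payoff \<Gamma> \<omega> T))") auto
qed

lemma measurable_stage_payoff [measurable]:
  fixes \<Gamma> :: "('s::finite, 'i::finite, 'j::finite) stoch_game"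
  assumes "t \<in> A"
  shows "(\<lambda>\<omega>. stage_payoff \<Gamma> (\<omega> t)) \<in> borel_measurable (PiM A (\<lambda>_. count_space UNIV))"
  by (rule measurable_compose[OF measurable_component_singleton[OF assms]]) auto

section \<open>A lower bound on the payoff from conditional means\<close>

text \<open>
  Hoeffding's lemma for a variable with range of length 1, centred at a lower bound \<open>c\<close> of its
  mean instead of the mean itself.
\<close>

lemma exponential_moment_stage:
  fixes \<Gamma> :: "('s::finite, 'i::finite, 'j::finite) stoch_game"
  assumes r: "\<And>s i j. payoff \<Gamma> s i j \<in> {0..1}"
    and c: "c \<le> measure_pmf.expectation p (stage_payoff \<Gamma>)" and "0 < l"
  shows "(\<integral>\<^sup>+x. ennreal (exp (l * (c - stage_payoff \<Gamma> x))) \<partial>measure_pmf p) \<le> ennreal (exp (l\<^sup>2 / 8))"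
proof -
  let ?X = "stage_payoff \<Gamma>" and ?E = "measure_pmf.expectation p"
  interpret interval_bounded_random_variable "measure_pmf p" "\<lambda>x. - ?X x" "-1" 0
    by unfold_locales (use r in \<open>auto split: prod.split\<close>)
  have "(\<integral>\<^sup>+x. ennreal (exp (l * (c - ?X x))) \<partial>measure_pmf p)
      \<le> (\<integral>\<^sup>+x. ennreal (exp (l * (- ?X x - ?E (\<lambda>x. - ?X x)))) \<partial>measure_pmf p)"
    using c \<open>0 < l\<close> by (intro nn_integral_mono) (simp add: ennreal_leI)
  also have "\<dots> \<le> ennreal (exp (l\<^sup>2 * (0 - (-1))\<^sup>2 / 8))"
    by (rule Hoeffdings_lemma_nn_integral[OF \<open>0 < l\<close>])
  finally show ?thesis by simp
qed

text \<open>
  Whatever the current state is, the next factor has conditional mean at most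
  \<open>exp (l\<^sup>2 / 8)\<close>; hence the exponential moments multiply as they do for independent variables.
\<close>

lemma exponential_moment_play:
  fixes \<Gamma> :: "('s::finite, 'i::finite, 'j::finite) stoch_game"
  assumes r: "\<And>s i j. payoff \<Gamma> s i j \<in> {0..1}"
    and c: "\<And>s'. c \<le> measure_pmf.expectation (stage_law \<sigma> \<tau> s') (stage_payoff \<Gamma>)" and "0 < l"
  shows "(\<integral>\<^sup>+\<omega>. ennreal (exp (l * (\<Sum>t<n. c - stage_payoff \<Gamma> (\<omega> t)))) \<partial>play_measure \<Gamma> s \<sigma> \<tau>)
    \<le> ennreal (exp (l\<^sup>2 / 8)) ^ n"
proof (induction n)
  case 0
  then show ?case
    using prob_space.emeasure_space_1[OF prob_space_play_measure, of \<Gamma> s \<sigma> \<tau>] by simp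
next
  case (Suc n)
  let ?M = "play_measure \<Gamma> s \<sigma> \<tau>" and ?X = "stage_payoff \<Gamma>"
  let ?F = "\<lambda>\<omega>. ennreal (exp (l * (\<Sum>t<n. c - ?X (\<omega> t))))"
  let ?g = "\<lambda>x. ennreal (exp (l * (c - ?X x)))"
  have "(\<integral>\<^sup>+\<omega>. ennreal (exp (l * (\<Sum>t<Suc n. c - ?X (\<omega> t)))) \<partial>?M) = (\<integral>\<^sup>+\<omega>. ?F \<omega> * ?g (\<omega> n) \<partial>?M)"
    by (simp add: distrib_left exp_add ennreal_mult)
  also have "\<dots> = (\<integral>\<^sup>+\<omega>. ?F \<omega> * (\<integral>\<^sup>+x. ?g x \<partial>play_kernel \<Gamma> s \<sigma> \<tau> n \<omega>) \<partial>?M)"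
  proof (rule nn_integral_play_step)
    show "?F \<in> borel_measurable (PiM {0..<n} (\<lambda>_. count_space UNIV))"
      by measurable
  qed simp
  also have "\<dots> \<le> (\<integral>\<^sup>+\<omega>. ?F \<omega> * ennreal (exp (l\<^sup>2 / 8)) \<partial>?M)"
  proof (intro nn_integral_mono mult_left_mono)
    fix \<omega>
    have "(\<integral>\<^sup>+x. ?g x \<partial>play_kernel \<Gamma> s \<sigma> \<tau> n \<omega>) =
        (\<integral>\<^sup>+s'. (\<integral>\<^sup>+x. ?g x \<partial>stage_law \<sigma> \<tau> s') \<partial>state_law \<Gamma> s n \<omega>)"
      by (simp add: play_kernel_def nn_integral_bind_pmf)
    also have "\<dots> \<le> (\<integral>\<^sup>+s'. ennreal (exp (l\<^sup>2 / 8)) \<partial>state_law \<Gamma> s n \<omega>)"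
      by (intro nn_integral_mono exponential_moment_stage r c \<open>0 < l\<close>)
    finally show "(\<integral>\<^sup>+x. ?g x \<partial>play_kernel \<Gamma> s \<sigma> \<tau> n \<omega>) \<le> ennreal (exp (l\<^sup>2 / 8))"
      by simp
  qed simp
  also have "\<dots> = (\<integral>\<^sup>+\<omega>. ?F \<omega> \<partial>?M) * ennreal (exp (l\<^sup>2 / 8))"
    by (rule nn_integral_multc) measurable
  also have "\<dots> \<le> ennreal (exp (l\<^sup>2 / 8)) ^ n * ennreal (exp (l\<^sup>2 / 8))"
    by (intro mult_right_mono Suc.IH) simp
  finally show ?case by (simp add: mult.commute)
qed

lemma prob_low_average_le:
  fixes \<Gamma> :: "('s::finite, 'i::finite, 'j::finite) stoch_game"
  assumes r: "\<And>s i j. payoff \<Gamma> s i j \<in> {0..1}"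
    and c: "\<And>s'. c \<le> measure_pmf.expectation (stage_law \<sigma> \<tau> s') (stage_payoff \<Gamma>)" and "0 < \<epsilon>"
  shows "measure (play_measure \<Gamma> s \<sigma> \<tau>)
      {\<omega> \<in> space (play_measure \<Gamma> s \<sigma> \<tau>). (\<Sum>t<n. stage_payoff \<Gamma> (\<omega> t)) \<le> real n * (c - \<epsilon>)}
    \<le> exp (- 2 * \<epsilon>\<^sup>2) ^ n"
proof -
  let ?M = "play_measure \<Gamma> s \<sigma> \<tau>" and ?S = "\<lambda>\<omega>. \<Sum>t<n. c - stage_payoff \<Gamma> (\<omega> t)"
  interpret prob_space ?M by (rule prob_space_play_measure)
  (* The exponent per stage is - l * \<epsilon> + l^2 / 8, which is least at l = 4 * \<epsilon>. *)
  let ?l = "4 * \<epsilon>"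
  have "{\<omega> \<in> space ?M. (\<Sum>t<n. stage_payoff \<Gamma> (\<omega> t)) \<le> real n * (c - \<epsilon>)} =
      {\<omega> \<in> space ?M. real n * \<epsilon> \<le> ?S \<omega>}"
    by (auto simp: sum_subtractf algebra_simps)
  also have "emeasure ?M \<dots> \<le> ennreal (exp (- ?l * (real n * \<epsilon>))) *
      (\<integral>\<^sup>+\<omega>. ennreal (exp (?l * ?S \<omega>)) * indicator (space ?M) \<omega> \<partial>?M)"
    using \<open>0 < \<epsilon>\<close> by (intro Chernoff_ineq_nn_integral_ge) (simp, simp, measurable)
  also have "(\<integral>\<^sup>+\<omega>. ennreal (exp (?l * ?S \<omega>)) * indicator (space ?M) \<omega> \<partial>?M) =
      (\<integral>\<^sup>+\<omega>. ennreal (exp (?l * ?S \<omega>)) \<partial>?M)"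
    by (intro nn_integral_cong) simp
  also have "ennreal (exp (- ?l * (real n * \<epsilon>))) * \<dots> \<le>
      ennreal (exp (- ?l * (real n * \<epsilon>))) * ennreal (exp (?l\<^sup>2 / 8)) ^ n"
    using \<open>0 < \<epsilon>\<close> by (intro mult_left_mono exponential_moment_play r c) auto
  also have "\<dots> = ennreal (exp (- 2 * \<epsilon>\<^sup>2) ^ n)"
    by (simp add: ennreal_power power2_eq_square algebra_simps flip: ennreal_mult exp_of_nat_mult exp_add)
  finally show ?thesis
    by (simp add: emeasure_eq_measure)
qed

text \<open>
  For each \<open>\<epsilon> > 0\<close> the probabilities of an average below \<open>c - \<epsilon>\<close> are summable, so almost surely the
  averages exceed \<open>c - \<epsilon>\<close> eventually. A bound on the expected averages would not suffice here,
  because Fatou's lemma bounds the expected limit inferior from above.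
\<close>

lemma gamma_ge:
  fixes \<Gamma> :: "('s::finite, 'i::finite, 'j::finite) stoch_game"
  assumes r: "\<And>s i j. payoff \<Gamma> s i j \<in> {0..1}"
    and c: "\<And>s'. c \<le> measure_pmf.expectation (stage_law \<sigma> \<tau> s') (stage_payoff \<Gamma>)"
  shows "c \<le> gamma \<Gamma> s \<sigma> \<tau>"
proof (rule field_le_epsilon)
  fix \<epsilon> :: real assume "0 < \<epsilon>"
  let ?M = "play_measure \<Gamma> s \<sigma> \<tau>"
  interpret prob_space ?M by (rule prob_space_play_measure)
  let ?A = "\<lambda>n. {\<omega> \<in> space ?M. (\<Sum>t<n. stage_payoff \<Gamma> (\<omega> t)) \<le> real n * (c - \<epsilon>)}"
  have "AE \<omega> in ?M. \<forall>\<^sub>F n in sequentially. \<omega> \<in> space ?M - ?A n"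
  proof (rule borel_cantelli_AE1)
    show "?A n \<in> sets ?M" for n by measurable
    have "summable (\<lambda>n. exp (- 2 * \<epsilon>\<^sup>2) ^ n)"
      using \<open>0 < \<epsilon>\<close> by (intro summable_geometric) simp
    then show "summable (\<lambda>n. measure ?M (?A n))"
      by (rule summable_comparison_test'[where N = 0])
        (use prob_low_average_le[OF r c \<open>0 < \<epsilon>\<close>] in simp)
  qed (simp add: emeasure_eq_measure)
  then have "AE \<omega> in ?M. c - \<epsilon> \<le> liminf_payoff \<Gamma> \<omega>"
  proof eventually_elim
    case (elim \<omega>)
    then have "\<forall>\<^sub>F T in sequentially. ereal (c - \<epsilon>) \<le> ereal (average_payoff \<Gamma> \<omega> T)"
      using eventually_gt_at_top[of 0]
      by eventually_elim (auto simp: field_simps)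
    then have "ereal (c - \<epsilon>) \<le> liminf (\<lambda>T. ereal (average_payoff \<Gamma> \<omega> T))"
      by (rule Liminf_bounded)
    then show ?case
      by (simp only: ereal_liminf_payoff[OF r, symmetric] ereal_less_eq)
  qed
  moreover have "integrable ?M (liminf_payoff \<Gamma>)"
    using liminf_payoff_bounds[OF r]
    by (intro integrable_const_bound[where B = 1]) (auto intro: measurable_liminf_payoff)
  ultimately have "c - \<epsilon> \<le> gamma \<Gamma> s \<sigma> \<tau>"
    unfolding gamma_def by (intro integral_ge_const)
  then show "c \<le> gamma \<Gamma> s \<sigma> \<tau> + \<epsilon>" by simp
qed

section \<open>An upper bound on the payoff against a static strategy\<close>

text \<open>
  From the second stage on, the state is the previous action of Player 2, which has law \<open>y\<close>
  whatever happened before; the initial state and Player 1 have no influence on it.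
\<close>

lemma nn_integral_static_stage:
  fixes \<Gamma> :: "('j::finite, 'i::finite, 'j) stoch_game" and g :: "'j \<times> 'i \<times> 'j \<Rightarrow> ennreal"
  assumes tr: "\<And>s i j. transition \<Gamma> s i j = return_pmf j"
  shows "(\<integral>\<^sup>+\<omega>. g (\<omega> (Suc m)) \<partial>play_measure \<Gamma> s \<sigma> (\<lambda>_. y)) =
    (\<integral>\<^sup>+s'. (\<integral>\<^sup>+x. g x \<partial>stage_law \<sigma> (\<lambda>_. y) s') \<partial>y)"
proof -
  let ?M = "play_measure \<Gamma> s \<sigma> (\<lambda>_. y)" and ?K = "play_kernel \<Gamma> s \<sigma> (\<lambda>_. y)"
  interpret prob_space ?M by (rule prob_space_play_measure)
  have step: "(\<integral>\<^sup>+\<omega>. h (\<omega> n) \<partial>?M) = (\<integral>\<^sup>+\<omega>. (\<integral>\<^sup>+x. h x \<partial>?K n \<omega>) \<partial>?M)" for h n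
    using nn_integral_play_step[where F = "\<lambda>_. 1" and g = h and n = n] by simp
  let ?G = "\<lambda>s'. \<integral>\<^sup>+x. g x \<partial>stage_law \<sigma> (\<lambda>_. y) s'"
  have "(\<integral>\<^sup>+\<omega>. g (\<omega> (Suc m)) \<partial>?M) = (\<integral>\<^sup>+\<omega>. (\<lambda>x. ?G (snd (snd x))) (\<omega> m) \<partial>?M)"
    by (subst step) (simp add: play_kernel_def state_law_def tr bind_return_pmf split_beta)
  also have "\<dots> = (\<integral>\<^sup>+\<omega>. (\<integral>\<^sup>+x. ?G (snd (snd x)) \<partial>?K m \<omega>) \<partial>?M)"
    by (rule step)
  also have "\<dots> = (\<integral>\<^sup>+\<omega>. (\<integral>\<^sup>+s'. ?G s' \<partial>y) \<partial>?M)"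
    by (simp add: play_kernel_def nn_integral_bind_pmf stage_law_def nn_integral_pair_pmf')
  finally show ?thesis
    by (simp add: emeasure_space_1)
qed

text \<open>
  By Fatou's lemma, the payoff is at most the limit inferior of the expected averages. All stages
  but the first have mean at most \<open>b\<close>, and the first adds at most \<open>1 / T\<close> to the average over \<open>T\<close>
  stages.
\<close>

lemma gamma_static_le:
  fixes \<Gamma> :: "('j::finite, 'i::finite, 'j) stoch_game"
  assumes tr: "\<And>s i j. transition \<Gamma> s i j = return_pmf j"
    and r: "\<And>s i j. payoff \<Gamma> s i j \<in> {0..1}"
    and b: "measure_pmf.expectation y
      (\<lambda>s'. measure_pmf.expectation (stage_law \<sigma> (\<lambda>_. y) s') (stage_payoff \<Gamma>)) \<le> b"
  shows "gamma \<Gamma> s \<sigma> (\<lambda>_. y) \<le> b"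
proof -
  let ?M = "play_measure \<Gamma> s \<sigma> (\<lambda>_. y)"
  interpret prob_space ?M by (rule prob_space_play_measure)
  let ?X = "stage_payoff \<Gamma>"
  have X: "0 \<le> ?X x" "?X x \<le> 1" for x using r by (auto split: prod.split)
  have int: "integrable (measure_pmf p) h" for p :: "'k::finite pmf" and h :: "'k \<Rightarrow> real"
    by (rule integrable_measure_pmf_finite) simp
  have "0 \<le> measure_pmf.expectation y
      (\<lambda>s'. measure_pmf.expectation (stage_law \<sigma> (\<lambda>_. y) s') ?X)"
    by (intro Bochner_Integration.integral_nonneg X)
  with b have "0 \<le> b" by linarith
  have stage: "(\<integral>\<^sup>+\<omega>. ennreal (?X (\<omega> (Suc m))) \<partial>?M) \<le> ennreal b" for m
    by (subst nn_integral_static_stage[OF tr]) (simp add: nn_integral_eq_integral[OF int] X b ennreal_leI)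
  have first: "(\<integral>\<^sup>+\<omega>. ennreal (?X (\<omega> 0)) \<partial>?M) \<le> 1"
  proof -
    have "(\<integral>\<^sup>+\<omega>. ennreal (?X (\<omega> 0)) \<partial>?M) \<le> (\<integral>\<^sup>+\<omega>. 1 \<partial>?M)"
      by (intro nn_integral_mono) (simp add: X)
    then show ?thesis by (simp add: emeasure_space_1)
  qed
  have mean: "(\<integral>\<^sup>+\<omega>. ennreal (average_payoff \<Gamma> \<omega> (Suc T)) \<partial>?M) \<le> ennreal (1 / real (Suc T) + b)" for T
  proof -
    have "(\<integral>\<^sup>+\<omega>. ennreal (average_payoff \<Gamma> \<omega> (Suc T)) \<partial>?M) =
        (\<integral>\<^sup>+\<omega>. ennreal (1 / real (Suc T)) * (\<Sum>t<Suc T. ennreal (?X (\<omega> t))) \<partial>?M)"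
      by (simp add: X sum_nonneg flip: ennreal_mult' del: sum.lessThan_Suc of_nat_Suc)
    also have "\<dots> = ennreal (1 / real (Suc T)) * (\<Sum>t<Suc T. \<integral>\<^sup>+\<omega>. ennreal (?X (\<omega> t)) \<partial>?M)"
      by (subst nn_integral_cmult) (simp_all add: nn_integral_sum del: sum.lessThan_Suc)
    also have "\<dots> \<le> ennreal (1 / real (Suc T)) * (1 + (\<Sum>t<T. ennreal b))"
      unfolding sum.lessThan_Suc_shift
      by (intro mult_left_mono add_mono first sum_mono stage) simp
    also have "1 + (\<Sum>t<T. ennreal b) = ennreal (1 + real T * b)"
      using \<open>0 \<le> b\<close> by (simp add: ennreal_mult ennreal_of_nat_eq_real_of_nat)
    also have "ennreal (1 / real (Suc T)) * \<dots> = ennreal (1 / real (Suc T) * (1 + real T * b))"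
      by (rule ennreal_mult'[symmetric]) simp
    also have "\<dots> \<le> ennreal (1 / real (Suc T) + b)"
      using \<open>0 \<le> b\<close> by (intro ennreal_leI) (simp add: field_simps)
    finally show ?thesis .
  qed
  have lim: "(\<lambda>T. ennreal (1 / real T + b)) \<longlonglongrightarrow> ennreal b"
  proof (rule tendsto_ennrealI)
    show "(\<lambda>T. 1 / real T + b) \<longlonglongrightarrow> b"
      using tendsto_add[OF lim_1_over_n tendsto_const[of b]] by simp
  qed
  have pointwise: "ennreal (liminf_payoff \<Gamma> \<omega>) = liminf (\<lambda>T. ennreal (average_payoff \<Gamma> \<omega> T))" for \<omega>
  proof -
    have "liminf (\<lambda>T. e2ennreal (ereal (average_payoff \<Gamma> \<omega> T))) =
        e2ennreal (liminf (\<lambda>T. ereal (average_payoff \<Gamma> \<omega> T)))"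
      by (rule Liminf_compose_continuous_mono)
        (auto intro: continuous_on_e2ennreal e2ennreal_mono monoI)
    then show ?thesis
      by (simp only: ereal_liminf_payoff[OF r, symmetric] e2ennreal_ereal)
  qed
  have "ennreal (gamma \<Gamma> s \<sigma> (\<lambda>_. y)) = (\<integral>\<^sup>+\<omega>. ennreal (liminf_payoff \<Gamma> \<omega>) \<partial>?M)"
    unfolding gamma_def
  proof (rule nn_integral_eq_integral[symmetric])
    show "integrable ?M (liminf_payoff \<Gamma>)"
      using liminf_payoff_bounds[OF r]
      by (intro integrable_const_bound[where B = 1]) (auto intro: measurable_liminf_payoff)
  qed (use liminf_payoff_bounds[OF r] in simp)
  also have "\<dots> = (\<integral>\<^sup>+\<omega>. liminf (\<lambda>T. ennreal (average_payoff \<Gamma> \<omega> T)) \<partial>?M)"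
    by (simp only: pointwise)
  also have "\<dots> \<le> liminf (\<lambda>T. \<integral>\<^sup>+\<omega>. ennreal (average_payoff \<Gamma> \<omega> T) \<partial>?M)"
    by (rule nn_integral_liminf) measurable
  also have "\<dots> \<le> liminf (\<lambda>T. ennreal (1 / real T + b))"
  proof (rule Liminf_mono)
    show "\<forall>\<^sub>F T in sequentially. (\<integral>\<^sup>+\<omega>. ennreal (average_payoff \<Gamma> \<omega> T) \<partial>?M) \<le> ennreal (1 / real T + b)"
      using eventually_gt_at_top[of 0]
    proof eventually_elim
      case (elim T)
      then show ?case using mean[of "T - 1"] by simp
    qed
  qed
  also have "\<dots> = ennreal b"
    by (rule lim_imp_Liminf[OF _ lim]) simp
  finally show ?thesis
    using \<open>0 \<le> b\<close> by simp
qed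

section \<open>Comparison of static and stationary strategies\<close>

lemma expectation_stage_law:
  fixes \<Gamma> :: "('s::finite, 'i::finite, 'j::finite) stoch_game"
  shows "measure_pmf.expectation (stage_law \<sigma> \<tau> s') (stage_payoff \<Gamma>) =
    measure_pmf.expectation (\<sigma> s') (\<lambda>i. measure_pmf.expectation (\<tau> s') (payoff \<Gamma> s' i))"
proof -
  have "measure_pmf.expectation (stage_law \<sigma> \<tau> s') (stage_payoff \<Gamma>) =
      measure_pmf.expectation (\<sigma> s' \<bind> (\<lambda>i. map_pmf (Pair i) (\<tau> s'))) (\<lambda>(i, j). payoff \<Gamma> s' i j)"
    by (simp add: stage_law_def) (simp add: pair_pmf_def map_pmf_def)
  also have "\<dots> = (\<Sum>i\<in>UNIV. pmf (\<sigma> s') i *\<^sub>R measure_pmf.expectation (\<tau> s') (payoff \<Gamma> s' i))"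
    by (subst pmf_expectation_bind[where A = UNIV]) auto
  also have "\<dots> = measure_pmf.expectation (\<sigma> s') (\<lambda>i. measure_pmf.expectation (\<tau> s') (payoff \<Gamma> s' i))"
    by (rule integral_measure_pmf[symmetric]) auto
  finally show ?thesis .
qed

text \<open>
  The witness is the static strategy \<open>y\<close> that tosses a fair coin and plays \<open>s\<^sub>0\<close> or \<open>p\<close>
  accordingly. Playing the action \<open>s\<^sub>0\<close> is only meant to bring about the state \<open>s\<^sub>0\<close>, in which \<open>p\<close>
  is a good action. The probability that one toss selects \<open>s\<^sub>0\<close> and the next one selects \<open>p\<close> is
  the product of the two weights of the coin, and it is largest, namely \<open>1/4\<close>, for a fair coin.
\<close>

lemma minimax_static_le:
  fixes \<Gamma> :: "('j::finite, 'i::finite, 'j) stoch_game"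
  assumes tr: "\<And>s i j. transition \<Gamma> s i j = return_pmf j"
    and r: "\<And>s i j. payoff \<Gamma> s i j \<in> {0..1}"
    and m: "\<And>i. measure_pmf.expectation p (payoff \<Gamma> s\<^sub>0 i) \<le> m"
  shows "minimax_static \<Gamma> s \<le> 3 / 4 + m / 4"
proof -
  define y where "y = bind_pmf (bernoulli_pmf (1 / 2)) (\<lambda>b. if b then return_pmf s\<^sub>0 else p)"
  have int: "integrable (measure_pmf q) h" for q :: "'k::finite pmf" and h :: "'k \<Rightarrow> real"
    by (rule integrable_measure_pmf_finite) simp
  have y: "measure_pmf.expectation y h = h s\<^sub>0 / 2 + measure_pmf.expectation p h / 2"
    for h :: "'j \<Rightarrow> real"
    unfolding y_def by (subst pmf_expectation_bind[where A = UNIV]) (auto simp: UNIV_bool)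
  have le: "measure_pmf.expectation q h \<le> c" if "\<And>x. h x \<le> c"
    for q :: "'k::finite pmf" and h :: "'k \<Rightarrow> real" and c
    using that by (intro measure_pmf.integral_le_const int) simp
  have "gamma \<Gamma> s \<sigma> (\<lambda>_. y) \<le> 3 / 4 + m / 4" for \<sigma>
  proof (rule gamma_static_le[OF tr r])
    let ?e = "\<lambda>s' i. measure_pmf.expectation y (payoff \<Gamma> s' i)"
    let ?E = "\<lambda>s'. measure_pmf.expectation (\<sigma> s') (?e s')"
    (* In state s\<^sub>0 the action s\<^sub>0 costs Player 2 at most 1 and the draw from p at most m. *)
    have "?e s\<^sub>0 i \<le> 1 / 2 + m / 2" for i
      using m[of i] r[of s\<^sub>0 i s\<^sub>0] by (simp add: y)
    then have "?E s\<^sub>0 \<le> 1 / 2 + m / 2"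
      by (rule le)
    moreover have "measure_pmf.expectation p ?E \<le> 1"
      using r by (intro le) auto
    ultimately have "measure_pmf.expectation y ?E \<le> 3 / 4 + m / 4"
      unfolding y[of ?E] by simp
    then show "measure_pmf.expectation y
        (\<lambda>s'. measure_pmf.expectation (stage_law \<sigma> (\<lambda>_. y) s') (stage_payoff \<Gamma>)) \<le> 3 / 4 + m / 4"
      by (simp only: expectation_stage_law)
  qed
  then have "(SUP \<sigma>. gamma \<Gamma> s \<sigma> (\<lambda>_. y)) \<le> 3 / 4 + m / 4"
    by (intro cSUP_least) auto
  moreover have "minimax_static \<Gamma> s \<le> (SUP \<sigma>. gamma \<Gamma> s \<sigma> (\<lambda>_. y))"
    unfolding minimax_static_def
  proof (rule cINF_lower)
    have bdd: "bdd_above (range (\<lambda>\<sigma>. gamma \<Gamma> s \<sigma> \<tau>))" for \<tau>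
      using gamma_bounds[OF r] by (intro bdd_aboveI2[where M = 1]) auto
    have "0 \<le> (SUP \<sigma>. gamma \<Gamma> s \<sigma> \<tau>)" for \<tau>
      using gamma_bounds[OF r] by (intro cSUP_upper2[OF bdd UNIV_I]) auto
    then show "bdd_below ((\<lambda>\<tau>. SUP \<sigma>. gamma \<Gamma> s \<sigma> \<tau>) ` static_strategies)"
      by (intro bdd_belowI2)
  qed (auto simp: static_strategies_def)
  ultimately show ?thesis by linarith
qed

text \<open>
  If Player 1 has in each state a reply to \<open>\<tau>\<close> that is worth \<open>c\<close> in expectation, then the pure
  stationary strategy made of these replies secures \<open>c\<close> in the long run, however \<open>\<tau>\<close> moves
  between the states.
\<close>

lemma SUP_gamma_ge:
  fixes \<Gamma> :: "('s::finite, 'i::finite, 'j::finite) stoch_game"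
  assumes r: "\<And>s i j. payoff \<Gamma> s i j \<in> {0..1}"
    and c: "\<And>s'. \<exists>i. c \<le> measure_pmf.expectation (\<tau> s') (payoff \<Gamma> s' i)"
  shows "c \<le> (SUP \<sigma>. gamma \<Gamma> s \<sigma> \<tau>)"
proof -
  obtain a where a: "\<And>s'. c \<le> measure_pmf.expectation (\<tau> s') (payoff \<Gamma> s' (a s'))"
    using c by metis
  have "c \<le> gamma \<Gamma> s (\<lambda>s'. return_pmf (a s')) \<tau>"
    by (rule gamma_ge[OF r]) (simp add: expectation_stage_law a)
  also have "\<dots> \<le> (SUP \<sigma>. gamma \<Gamma> s \<sigma> \<tau>)"
    using gamma_bounds[OF r] by (intro cSUP_upper bdd_aboveI2[where M = 1]) auto
  finally show ?thesis .
qed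

theorem theorem5:
  fixes \<Gamma> :: "('j::finite, 'i::finite, 'j) stoch_game" and s :: 'j
  assumes "class_G \<Gamma>"
  shows "minimax_static \<Gamma> s - minimax_stationary \<Gamma> s \<le> 3 / 4 * (1 - minimax_stationary \<Gamma> s) \<and>
    (minimax_stationary \<Gamma> s < 1 \<longrightarrow>
      (1 - minimax_static \<Gamma> s) / (1 - minimax_stationary \<Gamma> s) \<ge> 1 / 4)"
proof -
  have tr: "\<And>s i j. transition \<Gamma> s i j = return_pmf j"
    and r: "\<And>s i j. payoff \<Gamma> s i j \<in> {0..1}"
    using assms by (auto simp: class_G_def)
  have "4 * minimax_static \<Gamma> s - 3 \<le> (SUP \<sigma>. gamma \<Gamma> s \<sigma> \<tau>)" for \<tau> :: "('j, 'j) stationary"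
  proof -
    define e where "e s' i = measure_pmf.expectation (\<tau> s') (payoff \<Gamma> s' i)" for s' i
    define best where "best s' = Max (range (e s'))" for s'
    define m where "m = Min (range best)"
    obtain s\<^sub>0 where s\<^sub>0: "m = best s\<^sub>0"
      using Min_in[of "range best"] unfolding m_def by fastforce
    have "minimax_static \<Gamma> s \<le> 3 / 4 + m / 4"
      by (rule minimax_static_le[OF tr r, where p = "\<tau> s\<^sub>0" and s\<^sub>0 = s\<^sub>0]) (simp add: s\<^sub>0 best_def flip: e_def)
    moreover have "m \<le> (SUP \<sigma>. gamma \<Gamma> s \<sigma> \<tau>)"
    proof (rule SUP_gamma_ge[OF r])
      fix s'
      obtain i where "best s' = e s' i"
        using Max_in[of "range (e s')"] unfolding best_def by fastforce
      then have "m \<le> e s' i"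
        using Min_le[OF finite_imageI[OF finite] rangeI, of best s'] by (simp add: m_def)
      then show "\<exists>i. m \<le> measure_pmf.expectation (\<tau> s') (payoff \<Gamma> s' i)"
        unfolding e_def ..
    qed
    ultimately show ?thesis by simp
  qed
  then have "4 * minimax_static \<Gamma> s - 3 \<le> minimax_stationary \<Gamma> s"
    unfolding minimax_stationary_def by (intro cINF_greatest) auto
  then show ?thesis
    by (auto simp: field_simps)
qed

end
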